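(* Under the standing assumptions on the data listed in the context, the vector optimization problem $\min_{z\in\mathcal{U}}\varphi(z)$ has a Pareto optimal solution, i.e. there exists $\overline{z}\in\mathcal{U}$ for which there is no $z\in\mathcal{U}$ with $\varphi_h(z)\le\varphi_h(\overline{z})$ for all $h=1,\dots,H$ and $\varphi_{h^*}(z)<\varphi_{h^*}(\overline{z})$ for at least one $h^*\in\{1,\dots,H\}$.
   Context: Data: positive integers $H,T$; real constants $r_t>0$, $\omega_t\ge 1$ ($t=0,\dots,T$), $l^h>0$, $\beta^h\in(0,1)$ ($h=1,\dots,H$), $\tau\ge 1$, $\delta\in(0,1)$; given initial values $a_0^1,\dots,a_0^H\in\mathbb{R}$ with $\sum_{h=1}^H a_0^h>0$. Utility functions $u^h:(0,\infty)\to\mathbb{R}$ ($h=1,\dots,H$) are twice continuously differentiable with $(u^h)'(c)>0$, $(u^h)''(c)<0$ for all $c>0$, $\lim_{c\to\infty}(u^h)'(c)=0$ and $\lim_{c\to 0}(u^h)'(c)=+\infty$ (Inada condition). Variables: $z=\big((c_t^h)_{t=0,\dots,T;\,h=1,\dots,H},(a_t^h)_{t=1,\dots,T+1;\,h=1,\dots,H}\big)\in\mathbb{R}^{2H(T+1)}$. The feasible set $\mathcal{U}$ consists of all $z$ with $c_t^h>0$ for all $t=0,\dots,T$, $h=1,\dots,H$, satisfying $$a_{t+1}^h=\tau\omega_t l^h+(\tau(1+r_t)-\delta)a_t^h-\tau c_t^h\quad(t=0,\dots,T,\ h=1,\dots,H),$$ $$\sum_{h=1}^H a_t^h\ge 0\quad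 (t=1,\dots,T+1).$$ The objective $\varphi=(\varphi_1,\dots,\varphi_H)$ is $\varphi_h(z)=-\sum_{t=0}^T(\beta^h)^t u^h(c_t^h)$, where $(\beta^h)^t$ is the $t$-th power of $\beta^h$. *)

theory Defs
  imports "HOL-Analysis.Analysis"
begin

(* Only the restriction of u to (0,infinity) matters: for c > 0 the iterated deriv at c
   depends only on the values of u near c. *)
definition inada_utility :: "(real \<Rightarrow> real) \<Rightarrow> bool" where
  "inada_utility u \<longleftrightarrow>
     (\<forall>c>0. u differentiable (at c)) \<and>
     (\<forall>c>0. deriv u differentiable (at c)) \<and>
     continuous_on {0<..} (deriv (deriv u)) \<and>
     (\<forall>c>0. deriv u c > 0) \<and>
     (\<forall>c>0. deriv (deriv u) c < 0) \<and>
     (deriv u \<longlongrightarrow> 0) at_top \<and>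
     filterlim (deriv u) at_top (at_right 0)"

(* A vector z = (c, a) in R^(2H(T+1)): c is indexed by (t, h) with t = 0..T and
   a by (t, h) with t = 1..T+1. Extensionality makes the components outside these ranges
   irrelevant. *)
type_synonym plan = "(nat \<times> nat \<Rightarrow> real) \<times> (nat \<times> nat \<Rightarrow> real)"

definition plan_space :: "nat \<Rightarrow> nat \<Rightarrow> plan set" where
  "plan_space H T =
     ({0..T} \<times> {1..H} \<rightarrow>\<^sub>E UNIV) \<times> ({1..T+1} \<times> {1..H} \<rightarrow>\<^sub>E UNIV)"

(* a_t^h for t = 0..T+1; the values at t = 0 are data, not components of z. *)
definition assets :: "(nat \<Rightarrow> real) \<Rightarrow> (nat \<times> nat \<Rightarrow> real) \<Rightarrow> nat \<Rightarrow> nat \<Rightarrow> real" where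
  "assets a0 a t h = (if t = 0 then a0 h else a (t, h))"

definition feasible_set ::
  "nat \<Rightarrow> nat \<Rightarrow> (nat \<Rightarrow> real) \<Rightarrow> (nat \<Rightarrow> real) \<Rightarrow> (nat \<Rightarrow> real) \<Rightarrow> real \<Rightarrow> real \<Rightarrow>
   (nat \<Rightarrow> real) \<Rightarrow> plan set"
where
  "feasible_set H T r \<omega> l \<tau> \<delta> a0 = {(c, a) \<in> plan_space H T.
     (\<forall>t\<in>{0..T}. \<forall>h\<in>{1..H}. c (t, h) > 0) \<and>
     (\<forall>t\<in>{0..T}. \<forall>h\<in>{1..H}.
        assets a0 a (t + 1) h =
          \<tau> * \<omega> t * l h + (\<tau> * (1 + r t) - \<delta>) * assets a0 a t h - \<tau> * c (t, h)) \<and>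
     (\<forall>t\<in>{1..T+1}. (\<Sum>h=1..H. assets a0 a t h) \<ge> 0)}"

definition objective ::
  "nat \<Rightarrow> (nat \<Rightarrow> real) \<Rightarrow> (nat \<Rightarrow> real \<Rightarrow> real) \<Rightarrow> nat \<Rightarrow> plan \<Rightarrow> real" where
  "objective T \<beta> u h z = - (\<Sum>t=0..T. \<beta> h ^ t * u h (fst z (t, h)))"

definition pareto_optimal :: "'i set \<Rightarrow> 'z set \<Rightarrow> ('i \<Rightarrow> 'z \<Rightarrow> real) \<Rightarrow> 'z \<Rightarrow> bool" where
  "pareto_optimal I U \<phi> z' \<longleftrightarrow> z' \<in> U \<and>
     \<not> (\<exists>z\<in>U. (\<forall>i\<in>I. \<phi> i z \<le> \<phi> i z') \<and> (\<exists>i\<in>I. \<phi> i z < \<phi> i z'))"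

end

theory Submission
  imports Defs
begin

text \<open>
  A maximiser of the total discounted utility of all households is Pareto optimal. The asset
  holdings are determined by the consumptions, which satisfy linear inequalities and are bounded,
  so only the possible loss of compactness as some \<open>c\<^sub>t\<^sup>h\<close> tends to \<open>0\<close> has to be excluded.
  Moving a plan with a very small component a fixed fraction towards a fixed positive plan costs at
  most a bounded amount in the other components, while by the Inada condition it gains more than
  that in the small one; and the moved plan is bounded away from \<open>0\<close>.
\<close>

section \<open>Maximising a sum of Inada utilities over a compact convex set\<close>

text \<open>Extensionality pins every coordinate outside \<open>I\<close> to
  \<open>undefined\<close>, so the set is a full product with singleton factors there, and Tychonoff
  applies.\<close>

lemma compact_PiE_UNIV:
  fixes S :: "'i \<Rightarrow> 'a::topological_space set"
  assumes "\<And>i. i \<in> I \<Longrightarrow> compact (S i)"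
  shows "compact (PiE I S)"
proof -
  have "PiE I S = PiE UNIV (\<lambda>i. if i \<in> I then S i else {undefined})"
    by (auto simp: PiE_iff extensional_def split: if_splits)
  moreover have "compactin (product_topology (\<lambda>_. euclidean) UNIV)
      (PiE UNIV (\<lambda>i. if i \<in> I then S i else {undefined}))"
    using assms by (simp add: compactin_PiE)
  ultimately show ?thesis
    by (simp add: euclidean_product_topology)
qed

text \<open>A function with non-increasing derivative lies below its tangents; the tangent is taken
  at \<open>y\<close>, the end point of the move, to bound the gain from below. Both orders of
  \<open>x\<close> and \<open>y\<close> follow from the mean value theorem.\<close>

lemma tangent_bound:
  fixes f f' :: "real \<Rightarrow> real"
  assumes der: "\<And>x. x > 0 \<Longrightarrow> (f has_real_derivative f' x) (at x)"
    and anti: "\<And>x y. 0 < x \<Longrightarrow> x \<le> y \<Longrightarrow> f' y \<le> f' x"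
    and "x > 0" "y > 0"
  shows "f' y * (y - x) \<le> f y - f x"
proof (cases x y rule: linorder_cases)
  case less
  then obtain z where "x < z" "z < y" "f y - f x = (y - x) * f' z"
    using MVT2[of x y f f'] der \<open>x > 0\<close> by auto
  with anti[of z y] \<open>x > 0\<close> less show ?thesis
    by (simp add: mult.commute mult_left_mono)
next
  case greater
  then obtain z where z: "y < z" "z < x" "f x - f y = (x - y) * f' z"
    using MVT2[of y x f f'] der \<open>y > 0\<close> by auto
  have "(x - y) * f' z \<le> (x - y) * f' y"
    using anti[of y z] z \<open>y > 0\<close> greater by (intro mult_left_mono) auto
  with z show ?thesis
    by (simp add: algebra_simps)
qed simp

text \<open>\<open>K\<close> may contain points with vanishing components, where the values of
  \<open>v\<close> carry no information. The maximum is therefore taken over the compact part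
  \<open>K'\<close> away from zero, and each positive point of \<open>K\<close> is shown to be
  matched or beaten by a point of \<open>K'\<close>.\<close>

lemma inada_sum_attains_max:
  fixes K :: "('i \<Rightarrow> real) set" and v v' :: "'i \<Rightarrow> real \<Rightarrow> real"
  assumes fin: "finite I" and K: "compact K"
    and conv: "\<And>x y s. x \<in> K \<Longrightarrow> y \<in> K \<Longrightarrow> 0 \<le> s \<Longrightarrow> s \<le> 1 \<Longrightarrow>
      (\<lambda>i. (1 - s) * x i + s * y i) \<in> K"
    and bnd: "\<And>x i. x \<in> K \<Longrightarrow> i \<in> I \<Longrightarrow> x i \<le> M" and "M > 0"
    and p: "p \<in> K" "\<And>i. i \<in> I \<Longrightarrow> p i > 0"
    and der: "\<And>i x. i \<in> I \<Longrightarrow> x > 0 \<Longrightarrow> (v i has_real_derivative v' i x) (at x)"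
    and anti: "\<And>i x y. i \<in> I \<Longrightarrow> 0 < x \<Longrightarrow> x \<le> y \<Longrightarrow> v' i y \<le> v' i x"
    and pos: "\<And>i x. i \<in> I \<Longrightarrow> x > 0 \<Longrightarrow> v' i x > 0"
    and inada: "\<And>i. i \<in> I \<Longrightarrow> filterlim (v' i) at_top (at_right 0)"
  obtains x where "x \<in> K" "\<And>i. i \<in> I \<Longrightarrow> x i > 0"
    "\<And>y. y \<in> K \<Longrightarrow> (\<And>i. i \<in> I \<Longrightarrow> y i > 0) \<Longrightarrow> (\<Sum>i\<in>I. v i (y i)) \<le> (\<Sum>i\<in>I. v i (x i))"
proof -
  \<comment> \<open>The inserted 1 keeps \<open>Min\<close> meaningful when \<open>I\<close> is
    empty.\<close>
  define m where "m = Min (insert 1 (p ` I))"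
  have m: "m > 0" "\<And>i. i \<in> I \<Longrightarrow> m \<le> p i"
    using fin p by (auto simp: m_def)
  define D where "D = (\<Sum>i\<in>I. v' i m)"
  have D: "v' i m \<le> D" if "i \<in> I" for i
    unfolding D_def by (rule member_le_sum) (use that fin m in \<open>auto intro!: less_imp_le[OF pos]\<close>)
  have "D \<ge> 0"
    unfolding D_def by (intro sum_nonneg less_imp_le pos m)
  \<comment> \<open>A marginal utility above \<open>B\<close> over a gap of at least
    \<open>m / 2\<close> outweighs \<open>card I\<close> losses of size at most
    \<open>D * M\<close>.\<close>
  define B where "B = card I * (D * M) / (m / 2)"
  have "\<forall>\<^sub>F x in at_right 0. \<forall>i\<in>I. B < v' i x"
    using inada fin by (auto simp: eventually_ball_finite_distrib filterlim_at_top_dense)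
  then obtain d where d: "d > 0" "\<And>i x. i \<in> I \<Longrightarrow> 0 < x \<Longrightarrow> x < d \<Longrightarrow> B < v' i x"
    unfolding eventually_at_right_field by auto
  \<comment> \<open>A component below \<open>e\<close> is at distance at least \<open>m / 2\<close>
    from \<open>p\<close>, and stays below \<open>d\<close> after growing by at most
    \<open>e\<close>; the choice of \<open>s\<close> ensures that the move adds no more than
    \<open>e\<close>.\<close>
  define e where "e = min (d / 2) (m / 2)"
  have e: "e > 0" "2 * e \<le> d" "e \<le> m / 2"
    using d m by (auto simp: e_def)
  define s where "s = min 1 (e / M)"
  have s: "0 < s" "s \<le> 1"
    using e \<open>M > 0\<close> by (auto simp: s_def)
  have "s \<le> e / M" by (simp add: s_def)
  then have sM: "s * M \<le> e"
    using \<open>M > 0\<close> by (simp add: pos_le_divide_eq)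
  \<comment> \<open>The bound \<open>e\<close> covers the points that are not moved, and
    \<open>s * m\<close> covers the moved ones.\<close>
  define \<epsilon> where "\<epsilon> = min e (s * m)"
  have \<epsilon>: "\<epsilon> > 0" using e s m by (simp add: \<epsilon>_def)
  define K' where "K' = {x \<in> K. \<forall>i\<in>I. \<epsilon> \<le> x i}"
  have "K' = K \<inter> (\<Inter>i\<in>I. {x. \<epsilon> \<le> x i})"
    by (auto simp: K'_def)
  moreover have "closed (\<Inter>i\<in>I. {x::'i \<Rightarrow> real. \<epsilon> \<le> x i})"
    by (intro closed_INT ballI closed_Collect_le continuous_intros continuous_on_product_coordinates)
  ultimately have "compact K'"
    using K by (simp add: compact_Int_closed)
  moreover have "p \<in> K'"
    using p m e by (fastforce simp: K'_def \<epsilon>_def)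
  moreover have "continuous_on K' (\<lambda>x. \<Sum>i\<in>I. v i (x i))"
  proof (intro continuous_on_sum)
    fix i assume i: "i \<in> I"
    have "continuous_on {0<..} (v i)"
      using der[OF i] by (meson DERIV_isCont continuous_at_imp_continuous_on greaterThan_iff)
    then show "continuous_on K' (\<lambda>x. v i (x i))"
      by (rule continuous_on_compose2)
        (use i \<epsilon> in \<open>force simp: K'_def intro: continuous_on_subset[OF continuous_on_product_coordinates]\<close>)+
  qed
  ultimately obtain x where x: "x \<in> K'"
    and max: "\<And>y. y \<in> K' \<Longrightarrow> (\<Sum>i\<in>I. v i (y i)) \<le> (\<Sum>i\<in>I. v i (x i))"
    using continuous_attains_sup[of K' "\<lambda>x. \<Sum>i\<in>I. v i (x i)"] by auto
  show thesis
  proof (rule that)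
    show "x \<in> K" "\<And>i. i \<in> I \<Longrightarrow> x i > 0"
      using x \<epsilon> by (fastforce simp: K'_def)+
  next
    fix y assume y: "y \<in> K" and ypos: "\<And>i. i \<in> I \<Longrightarrow> y i > 0"
    show "(\<Sum>i\<in>I. v i (y i)) \<le> (\<Sum>i\<in>I. v i (x i))"
    proof (cases "\<forall>i\<in>I. e \<le> y i")
      case True
      with y have "y \<in> K'" by (auto simp: K'_def \<epsilon>_def)
      then show ?thesis by (rule max)
    next
      case False
      then obtain j where j: "j \<in> I" "y j < e" by auto
      define w where "w = (\<lambda>i. (1 - s) * y i + s * p i)"
      have w_ge: "s * m \<le> w i" if "i \<in> I" for i
      proof -
        have "s * m \<le> s * p i" "0 \<le> (1 - s) * y i"
          using m(2)[OF that] s ypos[OF that] by auto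
        then show ?thesis by (simp add: w_def)
      qed
      have "w \<in> K"
        unfolding w_def by (rule conv) (use y p s in auto)
      with w_ge have "w \<in> K'"
        by (auto simp: K'_def \<epsilon>_def min.coboundedI2)
      have wpos: "w i > 0" if "i \<in> I" for i
        using w_ge[OF that] mult_pos_pos[OF \<open>0 < s\<close> \<open>m > 0\<close>] by linarith
      \<comment> \<open>The tangent bound at \<open>w i\<close>, with
        \<open>w i - y i = s * (p i - y i)\<close>.\<close>
      have gain: "s * (v' i (w i) * (p i - y i)) \<le> v i (w i) - v i (y i)" if "i \<in> I" for i
        using tangent_bound[of "v i" "v' i" "y i" "w i", OF der[OF that] anti[OF that]]
          ypos[OF that] wpos[OF that]
        by (simp add: w_def algebra_simps)
      \<comment> \<open>A component can lose only if \<open>y i > p i\<close>; then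
        \<open>w i\<close> stays above \<open>p i\<close>, hence above \<open>m\<close>, where
        marginal utility is at most \<open>D\<close>.\<close>
      have other: "- (D * M) \<le> v' i (w i) * (p i - y i)" if i: "i \<in> I" for i
      proof (cases "y i \<le> p i")
        case True
        with pos[OF i wpos[OF i]] have "0 \<le> v' i (w i) * (p i - y i)" by simp
        with \<open>D \<ge> 0\<close> \<open>M > 0\<close> show ?thesis
          by (smt (verit) mult_nonneg_nonneg)
      next
        case False
        have "p i \<le> w i"
          using mult_left_mono[of "p i" "y i" "1 - s"] False s
          by (simp add: w_def algebra_simps)
        with m(2)[OF i] have "m \<le> w i" by linarith
        then have "v' i (w i) \<le> D"
          using anti[OF i \<open>m > 0\<close>] D[OF i] order_trans by blast
        moreover have "y i - p i \<le> M"
          using bnd[OF y i] p(2)[OF i] by linarith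
        ultimately have "v' i (w i) * (y i - p i) \<le> D * M"
          using False \<open>D \<ge> 0\<close> by (intro mult_mono) auto
        then show ?thesis by (simp add: algebra_simps)
      qed
      \<comment> \<open>Indeed \<open>w j < e + s * M\<close>, which is at most \<open>2 * e\<close>
        and so at most \<open>d\<close>.\<close>
      have "w j < d"
      proof -
        have "(1 - s) * y j \<le> y j"
          using ypos[OF j(1)] s by (simp add: algebra_simps)
        moreover have "s * p j \<le> s * M"
          using bnd[OF p(1) j(1)] s by simp
        ultimately show ?thesis
          using j sM e by (simp add: w_def)
      qed
      then have "B < v' j (w j)"
        using d j wpos by blast
      then have "B * (m / 2) < v' j (w j) * (m / 2)"
        using m by simp
      also have "v' j (w j) * (m / 2) \<le> v' j (w j) * (p j - y j)"
        using pos[OF j(1) wpos[OF j(1)]] m(2)[OF j(1)] j(2) e by (intro mult_left_mono) auto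
      finally have "card I * (D * M) < v' j (w j) * (p j - y j)"
        using m by (simp add: B_def)
      moreover have "- (card I * (D * M)) \<le> (\<Sum>i\<in>I - {j}. v' i (w i) * (p i - y i))"
      proof -
        have "- (card I * (D * M)) \<le> - (card (I - {j}) * (D * M))"
          using \<open>D \<ge> 0\<close> \<open>M > 0\<close> fin by (simp add: mult_right_mono card_mono card_Diff1_le)
        also have "\<dots> = (\<Sum>i\<in>I - {j}. - (D * M))" by simp
        also have "\<dots> \<le> (\<Sum>i\<in>I - {j}. v' i (w i) * (p i - y i))"
          by (intro sum_mono other) auto
        finally show ?thesis .
      qed
      ultimately have "0 \<le> (\<Sum>i\<in>I. v' i (w i) * (p i - y i))"
        using j fin by (simp add: sum.remove)
      then have "0 \<le> (\<Sum>i\<in>I. s * (v' i (w i) * (p i - y i)))"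
        using s by (simp flip: sum_distrib_left)
      also have "\<dots> \<le> (\<Sum>i\<in>I. v i (w i) - v i (y i))"
        by (intro sum_mono gain)
      finally have "(\<Sum>i\<in>I. v i (y i)) \<le> (\<Sum>i\<in>I. v i (w i))"
        by (simp add: sum_subtractf)
      also have "\<dots> \<le> (\<Sum>i\<in>I. v i (x i))"
        by (rule max) fact
      finally show ?thesis .
    qed
  qed
qed


section \<open>Asset holdings as functions of consumption\<close>

text \<open>The asset equation as a forward recursion, which eliminates the asset variables.
  \<open>y\<close> stands for the labour income term and \<open>k\<close> for the factor on previous
  assets.\<close>

primrec holdings ::
  "(nat \<Rightarrow> real) \<Rightarrow> (nat \<Rightarrow> nat \<Rightarrow> real) \<Rightarrow> (nat \<Rightarrow> real) \<Rightarrow> real \<Rightarrow>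
   (nat \<times> nat \<Rightarrow> real) \<Rightarrow> nat \<Rightarrow> nat \<Rightarrow> real"
where
  "holdings a0 y k \<tau> c 0 h = a0 h"
| "holdings a0 y k \<tau> c (Suc t) h = y t h + k t * holdings a0 y k \<tau> c t h - \<tau> * c (t, h)"

lemma holdings_convex_combination:
  "holdings a0 y k \<tau> (\<lambda>i. (1 - s) * c i + s * c' i) t h =
     (1 - s) * holdings a0 y k \<tau> c t h + s * holdings a0 y k \<tau> c' t h"
proof (induction t)
  case (Suc t)
  show ?case
    unfolding holdings.simps Suc.IH by (simp add: algebra_simps)
qed (simp add: algebra_simps)

lemma continuous_on_holdings:
  "continuous_on UNIV (\<lambda>c. holdings a0 y k \<tau> c t h)"
  by (induction t) (auto intro!: continuous_intros continuous_on_product_coordinates)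

lemma holdings_antimono:
  assumes "\<And>i. i < t \<Longrightarrow> k i \<ge> 0" "\<tau> \<ge> 0" "\<And>i. i < t \<Longrightarrow> c (i, h) \<le> c' (i, h)"
  shows "holdings a0 y k \<tau> c' t h \<le> holdings a0 y k \<tau> c t h"
  using assms by (induction t) (auto intro!: diff_mono add_mono mult_left_mono)

text \<open>Income and consumption cancel at every date, so initial assets merely compound. This
  gives the fixed positive plan needed for the maximisation.\<close>

lemma holdings_consume_income:
  assumes "\<And>i. i < t \<Longrightarrow> \<tau> * c (i, h) = y i h"
  shows "holdings a0 y k \<tau> c t h = (\<Prod>i<t. k i) * a0 h"
  using assms by (induction t) auto

text \<open>Single households may borrow, so the bound must come from aggregate solvency: one
  household's spending is at most the total spending at \<open>t\<close>, hence at most the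
  aggregate resources at \<open>t\<close>, which would be largest had nobody consumed
  before.\<close>

lemma consumption_le:
  assumes "\<tau> > 0" "\<And>i. i \<le> t \<Longrightarrow> k i \<ge> 0"
    and "\<And>i h. i \<le> t \<Longrightarrow> h \<in> A \<Longrightarrow> c (i, h) \<ge> 0"
    and solvent: "(\<Sum>h\<in>A. holdings a0 y k \<tau> c (Suc t) h) \<ge> 0"
    and "finite A" "h \<in> A"
  shows "c (t, h) \<le> (\<Sum>h\<in>A. holdings a0 y k \<tau> (\<lambda>_. 0) (Suc t) h) / \<tau>"
proof -
  have "\<tau> * c (t, h) \<le> (\<Sum>h\<in>A. \<tau> * c (t, h))"
    using assms by (intro member_le_sum) auto
  also have "\<dots> \<le> (\<Sum>h\<in>A. y t h + k t * holdings a0 y k \<tau> c t h)"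
    using solvent by (simp add: sum_subtractf)
  also have "\<dots> \<le> (\<Sum>h\<in>A. holdings a0 y k \<tau> (\<lambda>_. 0) (Suc t) h)"
    using assms by (auto intro!: sum_mono mult_left_mono holdings_antimono)
  finally show ?thesis
    using \<open>\<tau> > 0\<close> by (simp add: pos_le_divide_eq mult.commute)
qed

text \<open>Positivity of consumption is left out so that only closed conditions remain; with it,
  this is the projection of the feasible set to consumptions.\<close>

definition solvent_consumptions ::
  "nat \<Rightarrow> nat \<Rightarrow> (nat \<Rightarrow> real) \<Rightarrow> (nat \<Rightarrow> nat \<Rightarrow> real) \<Rightarrow> (nat \<Rightarrow> real) \<Rightarrow> real \<Rightarrow>
   (nat \<times> nat \<Rightarrow> real) set"
where
  "solvent_consumptions H T a0 y k \<tau> = {c \<in> {0..T} \<times> {1..H} \<rightarrow>\<^sub>E UNIV.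
     \<forall>t\<in>{1..T+1}. (\<Sum>h=1..H. holdings a0 y k \<tau> c t h) \<ge> 0}"

text \<open>Induction on \<open>t\<close> identifies the assets of a feasible plan with
  \<open>holdings\<close>.\<close>

lemma feasible_setD:
  fixes r \<omega> l :: "nat \<Rightarrow> real" and \<tau> \<delta> :: real
  defines "y \<equiv> \<lambda>t h. \<tau> * \<omega> t * l h" and "k \<equiv> \<lambda>t. \<tau> * (1 + r t) - \<delta>"
  assumes z: "z \<in> feasible_set H T r \<omega> l \<tau> \<delta> a0"
  shows "fst z \<in> solvent_consumptions H T a0 y k \<tau>"
    and "\<And>i. i \<in> {0..T} \<times> {1..H} \<Longrightarrow> fst z i > 0"
proof -
  obtain c a where ca: "z = (c, a)" by fastforce
  have holdings: "assets a0 a t h = holdings a0 y k \<tau> c t h" if "t \<le> T + 1" "h \<in> {1..H}" for t h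
    using that
  proof (induction t)
    case (Suc t)
    then have "assets a0 a (t + 1) h = y t h + k t * assets a0 a t h - \<tau> * c (t, h)"
      using z by (auto simp: ca feasible_set_def y_def k_def)
    with Suc show ?case by simp
  qed (simp add: assets_def)
  then have "(\<Sum>h=1..H. assets a0 a t h) = (\<Sum>h=1..H. holdings a0 y k \<tau> c t h)" if "t \<le> T + 1" for t
    using that by (intro sum.cong) auto
  with z show "fst z \<in> solvent_consumptions H T a0 y k \<tau>"
    by (auto simp: ca feasible_set_def plan_space_def solvent_consumptions_def)
  show "\<And>i. i \<in> {0..T} \<times> {1..H} \<Longrightarrow> fst z i > 0"
    using z by (auto simp: ca feasible_set_def)
qed

lemma feasible_setI:
  fixes r \<omega> l :: "nat \<Rightarrow> real" and \<tau> \<delta> :: real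
  defines "y \<equiv> \<lambda>t h. \<tau> * \<omega> t * l h" and "k \<equiv> \<lambda>t. \<tau> * (1 + r t) - \<delta>"
  assumes c: "c \<in> solvent_consumptions H T a0 y k \<tau>"
    and pos: "\<And>i. i \<in> {0..T} \<times> {1..H} \<Longrightarrow> c i > 0"
  shows "(c, restrict (\<lambda>(t, h). holdings a0 y k \<tau> c t h) ({1..T+1} \<times> {1..H}))
    \<in> feasible_set H T r \<omega> l \<tau> \<delta> a0"
proof -
  let ?a = "restrict (\<lambda>(t, h). holdings a0 y k \<tau> c t h) ({1..T+1} \<times> {1..H})"
  have holdings: "assets a0 ?a t h = holdings a0 y k \<tau> c t h" if "t \<le> T + 1" "h \<in> {1..H}" for t h
    using that by (auto simp: assets_def)
  then have "(\<Sum>h=1..H. assets a0 ?a t h) = (\<Sum>h=1..H. holdings a0 y k \<tau> c t h)" if "t \<le> T + 1" for t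
    using that by (intro sum.cong) auto
  moreover have "assets a0 ?a (t + 1) h =
      \<tau> * \<omega> t * l h + (\<tau> * (1 + r t) - \<delta>) * assets a0 ?a t h - \<tau> * c (t, h)"
    if "t \<le> T" "h \<in> {1..H}" for t h
    using that holdings[of t h] holdings[of "t + 1" h] by (simp add: y_def k_def)
  ultimately show ?thesis
    using c pos by (auto simp: feasible_set_def plan_space_def solvent_consumptions_def)
qed

section \<open>Scalarisation and consequences of the utility assumptions\<close>

text \<open>A point dominating \<open>z'\<close> would have a strictly smaller sum of
  objectives.\<close>

lemma pareto_optimal_if_minimizes_sum:
  fixes \<phi> :: "'i \<Rightarrow> 'z \<Rightarrow> real"
  assumes "finite I" "z' \<in> U" "\<And>z. z \<in> U \<Longrightarrow> (\<Sum>i\<in>I. \<phi> i z') \<le> (\<Sum>i\<in>I. \<phi> i z)"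
  shows "pareto_optimal I U \<phi> z'"
  unfolding pareto_optimal_def
  using assms sum_strict_mono_ex1[of I] by (meson linorder_not_less)

lemma inada_utilityD:
  assumes "inada_utility u"
  shows "x > 0 \<Longrightarrow> (u has_real_derivative deriv u x) (at x)"
    and "0 < x \<Longrightarrow> x \<le> y \<Longrightarrow> deriv u y \<le> deriv u x"
    and "x > 0 \<Longrightarrow> deriv u x > 0"
    and "filterlim (deriv u) at_top (at_right 0)"
proof -
  have der: "(f has_real_derivative deriv f x) (at x)" if "f differentiable (at x)" for f and x :: real
    using that DERIV_imp_deriv by (metis real_differentiable_def)
  show "x > 0 \<Longrightarrow> (u has_real_derivative deriv u x) (at x)"
    using assms der by (simp add: inada_utility_def)
  show "deriv u y \<le> deriv u x" if "0 < x" "x \<le> y"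
  proof (rule DERIV_nonpos_imp_nonincreasing[OF \<open>x \<le> y\<close>])
    fix z assume "x \<le> z"
    with \<open>0 < x\<close> have "0 < z" by simp
    then show "\<exists>d. (deriv u has_real_derivative d) (at z) \<and> d \<le> 0"
      using assms der[of "deriv u" z] by (force simp: inada_utility_def intro: less_imp_le)
  qed
qed (use assms in \<open>auto simp: inada_utility_def\<close>)

section \<open>Existence of a Pareto optimal plan\<close>

theorem theorem1:
  fixes H T :: nat
    and r \<omega> l \<beta> a0 :: "nat \<Rightarrow> real"
    and \<tau> \<delta> :: real
    and u :: "nat \<Rightarrow> real \<Rightarrow> real"
  assumes "H > 0" and "T > 0"
    and "\<And>t. t \<in> {0..T} \<Longrightarrow> r t > 0"
    and "\<And>t. t \<in> {0..T} \<Longrightarrow> \<omega> t \<ge> 1"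
    and "\<And>h. h \<in> {1..H} \<Longrightarrow> l h > 0"
    and "\<And>h. h \<in> {1..H} \<Longrightarrow> 0 < \<beta> h \<and> \<beta> h < 1"
    and "\<tau> \<ge> 1"
    and "0 < \<delta>" and "\<delta> < 1"
    and "(\<Sum>h=1..H. a0 h) > 0"
    and "\<And>h. h \<in> {1..H} \<Longrightarrow> inada_utility (u h)"
  shows "\<exists>z. pareto_optimal {1..H} (feasible_set H T r \<omega> l \<tau> \<delta> a0) (objective T \<beta> u) z"
proof -
  define y where "y = (\<lambda>t h. \<tau> * \<omega> t * l h)"
  define k where "k = (\<lambda>t. \<tau> * (1 + r t) - \<delta>)"
  define I where "I = {0..T} \<times> {1..H}"
  define C where "C = solvent_consumptions H T a0 y k \<tau>"
  \<comment> \<open>Each pair of date and household is one coordinate, with the discount factor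
    absorbed into its utility.\<close>
  define v where "v = (\<lambda>(t, h) x. \<beta> h ^ t * u h x)"
  define v' where "v' = (\<lambda>(t, h) x. \<beta> h ^ t * deriv (u h) x)"
  have "\<tau> > 0" using assms by simp
  have k: "k t > 0" if "t \<le> T" for t
  proof -
    have "1 * 1 \<le> \<tau> * (1 + r t)"
      using assms(3)[of t] assms(7) that by (intro mult_mono) auto
    with \<open>\<delta> < 1\<close> show ?thesis by (simp add: k_def)
  qed
  \<comment> \<open>Summing absolute values over all dates gives one bound for every date; the added
    1 makes \<open>M\<close> positive.\<close>
  define M where
    "M = (\<Sum>t=0..T. \<bar>(\<Sum>h=1..H. holdings a0 y k \<tau> (\<lambda>_. 0) (Suc t) h) / \<tau>\<bar>) + 1"
  have M: "c i \<le> M" if c: "c \<in> C" "\<And>i. i \<in> I \<Longrightarrow> c i \<ge> 0" and i: "i \<in> I" for c i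
  proof -
    obtain t h where th: "i = (t, h)" "t \<le> T" "h \<in> {1..H}"
      using i by (auto simp: I_def)
    have "c (t, h) \<le> (\<Sum>h=1..H. holdings a0 y k \<tau> (\<lambda>_. 0) (Suc t) h) / \<tau>"
    proof (rule consumption_le)
      show "0 \<le> (\<Sum>h=1..H. holdings a0 y k \<tau> c (Suc t) h)"
        using c(1) th by (simp add: C_def solvent_consumptions_def del: holdings.simps)
    qed (use k th c(2) \<open>\<tau> > 0\<close> in \<open>auto simp: I_def intro: less_imp_le\<close>)
    also have "\<dots> \<le> \<bar>(\<Sum>h=1..H. holdings a0 y k \<tau> (\<lambda>_. 0) (Suc t) h) / \<tau>\<bar>"
      by (rule abs_ge_self)
    also have "\<dots> \<le> (\<Sum>t=0..T. \<bar>(\<Sum>h=1..H. holdings a0 y k \<tau> (\<lambda>_. 0) (Suc t) h) / \<tau>\<bar>)"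
      by (rule member_le_sum) (use th in auto)
    finally show ?thesis by (simp add: M_def th)
  qed
  define K where "K = PiE I (\<lambda>_. {0..M}) \<inter>
    (\<Inter>t\<in>{1..T+1}. {c. (\<Sum>h=1..H. holdings a0 y k \<tau> c t h) \<ge> 0})"
  have K_iff: "c \<in> K \<longleftrightarrow> c \<in> C \<and> (\<forall>i\<in>I. c i \<in> {0..M})" for c
    by (auto simp: K_def C_def solvent_consumptions_def I_def PiE_iff)
  \<comment> \<open>Every household consumes exactly its labour income, since
    \<open>\<tau> * p (t, h) = y t h\<close> on \<open>I\<close>.\<close>
  define p where "p = restrict (\<lambda>(t, h). \<omega> t * l h) I"
  have p_pos: "p i > 0" if "i \<in> I" for i
  proof -
    from that obtain t h where "i = (t, h)" "t \<in> {0..T}" "h \<in> {1..H}"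
      by (auto simp: I_def)
    with that assms(4)[of t] assms(5)[of h] show ?thesis by (simp add: p_def)
  qed
  \<comment> \<open>All households share the compounding factor, so the sign of the total initial
    assets decides, even if some \<open>a0 h\<close> are negative.\<close>
  have "(\<Sum>h=1..H. holdings a0 y k \<tau> p t h) \<ge> 0" if "t \<in> {1..T+1}" for t
  proof -
    have "(\<Sum>h=1..H. holdings a0 y k \<tau> p t h) = (\<Sum>h=1..H. (\<Prod>i<t. k i) * a0 h)"
      using that by (intro sum.cong holdings_consume_income) (auto simp: p_def I_def y_def)
    also have "\<dots> = (\<Prod>i<t. k i) * (\<Sum>h=1..H. a0 h)"
      by (simp add: sum_distrib_left)
    also have "\<dots> \<ge> 0"
      using k that assms(10) by (intro mult_nonneg_nonneg prod_nonneg) (auto intro: less_imp_le)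
    finally show ?thesis .
  qed
  then have "p \<in> C"
    by (auto simp: C_def solvent_consumptions_def p_def I_def)
  with p_pos M have "p \<in> K"
    by (simp add: K_iff less_imp_le)
  obtain c where c: "c \<in> K" "\<And>i. i \<in> I \<Longrightarrow> c i > 0"
    and max: "\<And>c'. c' \<in> K \<Longrightarrow> (\<And>i. i \<in> I \<Longrightarrow> c' i > 0) \<Longrightarrow>
      (\<Sum>i\<in>I. v i (c' i)) \<le> (\<Sum>i\<in>I. v i (c i))"
  proof (rule inada_sum_attains_max[of I K M p v v'])
    show "finite I" by (simp add: I_def)
    show "compact K"
      unfolding K_def
      by (intro compact_Int_closed compact_PiE_UNIV closed_INT ballI closed_Collect_le
          continuous_on_sum continuous_on_holdings continuous_on_const compact_Icc)
    show "M > 0" unfolding M_def by (rule add_nonneg_pos) (auto intro: sum_nonneg)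
    show "p \<in> K" "\<And>i. i \<in> I \<Longrightarrow> p i > 0" by fact+
    show "c i \<le> M" if "c \<in> K" "i \<in> I" for c i
      using that by (simp add: K_iff)
    show "(\<lambda>i. (1 - s) * x i + s * x' i) \<in> K" if "x \<in> K" "x' \<in> K" "0 \<le> s" "s \<le> 1" for x x' s
    proof -
      let ?w = "\<lambda>i. (1 - s) * x i + s * x' i"
      have "?w i \<in> {0..M}" if "i \<in> I" for i
        using \<open>x \<in> K\<close> \<open>x' \<in> K\<close> \<open>0 \<le> s\<close> \<open>s \<le> 1\<close> that convex_bound_le[of "x i" M "x' i" "1 - s" s]
        by (auto simp: K_iff)
      \<comment> \<open>The weights add up to 1, so combining \<open>undefined\<close> with itself
        returns \<open>undefined\<close> and extensionality survives.\<close>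
      moreover have "?w i = undefined" if "i \<notin> I" for i
      proof -
        have "x i = undefined" "x' i = undefined"
          using \<open>x \<in> K\<close> \<open>x' \<in> K\<close> that PiE_arb[of _ I "\<lambda>_. {0..M}" i] by (auto simp: K_def)
        then show ?thesis by (simp add: algebra_simps)
      qed
      moreover have "(\<Sum>h=1..H. holdings a0 y k \<tau> ?w t h) \<ge> 0" if "t \<in> {1..T+1}" for t
        using \<open>x \<in> K\<close> \<open>x' \<in> K\<close> \<open>0 \<le> s\<close> \<open>s \<le> 1\<close> that
        by (auto simp: K_def holdings_convex_combination sum.distrib simp flip: sum_distrib_left)
      ultimately show ?thesis
        by (auto simp: K_def PiE_iff extensional_def)
    qed
  next
    fix i assume "i \<in> I"
    then obtain t h where i: "i = (t, h)" "h \<in> {1..H}" by (auto simp: I_def)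
    note u = inada_utilityD[OF assms(11)[OF i(2)]]
    have \<beta>: "\<beta> h ^ t > 0" using assms(6)[OF i(2)] by simp
    show "(v i has_real_derivative v' i x) (at x)" if "x > 0" for x
      unfolding i v_def v'_def prod.case by (intro DERIV_cmult u that)
    show "v' i x' \<le> v' i x" if "0 < x" "x \<le> x'" for x x'
      using u(2)[OF that] \<beta> by (simp add: i v'_def)
    show "v' i x > 0" if "x > 0" for x
      using u(3)[OF that] \<beta> by (simp add: i v'_def)
    show "filterlim (v' i) at_top (at_right 0)"
      unfolding i v'_def prod.case
      by (rule filterlim_tendsto_pos_mult_at_top[OF tendsto_const \<beta> u(4)])
  qed (use that in blast)
  \<comment> \<open>The sum of the objectives depends on consumption alone, so maximising over
    \<open>K\<close> minimises it.\<close>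
  have objective: "(\<Sum>h=1..H. objective T \<beta> u h z) = - (\<Sum>i\<in>I. v i (fst z i))" for z
    unfolding objective_def I_def v_def sum_negf
    by (subst sum.swap) (simp add: sum.cartesian_product case_prod_unfold)
  let ?z = "(c, restrict (\<lambda>(t, h). holdings a0 y k \<tau> c t h) ({1..T+1} \<times> {1..H}))"
  have "pareto_optimal {1..H} (feasible_set H T r \<omega> l \<tau> \<delta> a0) (objective T \<beta> u) ?z"
  proof (rule pareto_optimal_if_minimizes_sum)
    show "?z \<in> feasible_set H T r \<omega> l \<tau> \<delta> a0"
      using c feasible_setI[of c H T a0 \<tau> \<omega> l r \<delta>] by (simp add: K_iff C_def I_def y_def k_def)
  next
    fix z assume z: "z \<in> feasible_set H T r \<omega> l \<tau> \<delta> a0"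
    have z_pos: "fst z i > 0" if "i \<in> I" for i
      using feasible_setD(2)[OF z] that by (simp add: I_def)
    moreover have "fst z \<in> C"
      using feasible_setD(1)[OF z] by (simp add: C_def y_def k_def)
    ultimately have "fst z \<in> K"
      using M by (simp add: K_iff less_imp_le)
    then show "(\<Sum>h=1..H. objective T \<beta> u h ?z) \<le> (\<Sum>h=1..H. objective T \<beta> u h z)"
      unfolding objective using max[of "fst z"] z_pos by simp
  qed simp
  then show ?thesis ..
qed

end
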